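(* Let $I\subseteq\mathbb R$ be an interval of nonzero length with $a=\inf I\in[-\infty,\infty)$, and suppose that $a\notin I$. Then, for any integer $j\ge0$ and any given set $M\subseteq\{j+1,j+2,\dots\}$, there exists a sequence $\mathbf w=(w_0,w_1,\dots)$ of positive Borel-measurable functions on $I$, each bounded on every compact subset of $I$, such that the set $F_{\mathbf w;j\bullet}\setminus\{j\}$ coincides with $M$.
   Context: Given $\mathbf w=(w_0,w_1,\dots)$ and integers $0\le j\le m$, define $p_{a;j,m}:I\to(0,\infty]$ recursively by $p_{a;m,m}(x)=w_m(x)$ and $p_{a;j,m}(x)=w_j(x)\int_{a}^{x}p_{a;j+1,m}(u)\,du$ for $j<m$, $x\in I$ (the integral being over $(a,x)$, possibly infinite). For each pair $j\le m$ the function $p_{a;j,m}$ is either finite everywhere on $I$ or $\infty$ everywhere on $I$. Then $F_{\mathbf w;j\bullet}=\{m\ge j: p_{a;j,m}<\infty\}$. *)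

theory Defs
  imports "HOL-Analysis.Analysis"
begin

(* w j is a total function on the reals, but for x in I and a = inf I only its values on I
   enter: (a, x) is then a subset of I.  For j > m the value w m x is a dummy. *)
function p_iter :: "ereal \<Rightarrow> (nat \<Rightarrow> real \<Rightarrow> real) \<Rightarrow> nat \<Rightarrow> nat \<Rightarrow> real \<Rightarrow> ennreal" where
  "p_iter a w j m x =
    (if j < m
     then ennreal (w j x) * (\<integral>\<^sup>+ u \<in> {u. a < ereal u \<and> u < x}. p_iter a w (Suc j) m u \<partial>lborel)
     else ennreal (w m x))"
  by pat_completeness auto
termination
  by (relation "Wellfounded.measure (\<lambda>(a, w, j, m, x). m - j)") auto

declare p_iter.simps [simp del]

(* For positive w_i that are bounded on compact subsets of I, each p_iter a w j m is either finite
   everywhere on I or infinite everywhere on I, so finiteness everywhere is the meaning of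
   "p_iter a w j m < infinity". *)
definition F_set :: "ereal \<Rightarrow> real set \<Rightarrow> (nat \<Rightarrow> real \<Rightarrow> real) \<Rightarrow> nat \<Rightarrow> nat set" where
  "F_set a I w j = {m. j \<le> m \<and> (\<forall>x\<in>I. p_iter a w j m x < \<infinity>)}"

end

theory Submission
  imports Defs
begin

text \<open>
  Let \<open>\<phi>\<close> be a positive function on \<open>(a, \<infinity>)\<close> with \<open>\<phi>' > 0\<close> and \<open>\<phi> \<rightarrow> 0\<close> at \<open>a\<close>: take \<open>u - a\<close> if
  \<open>a\<close> is finite and \<open>exp u\<close> otherwise.  With \<open>S k = k\<close> for \<open>k \<in> M\<close> and \<open>S k = 0\<close> for \<open>k \<notin> M\<close>, the
  weights \<open>w\<^sub>k = \<phi>' \<phi> ^ S k / \<phi> ^ (S (k - 1) + 1)\<close> make the iterated integral telescope: as long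
  as all integrals converge, \<open>p\<^sub>k\<^sub>,\<^sub>m\<close> is a constant multiple of \<open>\<phi>' \<phi> ^ S m / \<phi> ^ (S (k - 1) + 1)\<close>,
  and the next integral converges iff \<open>S (k - 1) < S m\<close>.  If \<open>m \<in> M\<close> then \<open>S m = m\<close> exceeds every
  earlier \<open>S k\<close>; if \<open>m \<notin> M\<close> then \<open>S m = 0\<close> and already the innermost integral diverges.
\<close>

section \<open>Gauge functions and integrals of their powers\<close>

locale vanishing_gauge =
  fixes a :: ereal and \<phi> g :: "real \<Rightarrow> real"
  assumes gauge_deriv: "a < ereal u \<Longrightarrow> (\<phi> has_real_derivative g u) (at u)"
    and deriv_cont: "a < ereal u \<Longrightarrow> isCont g u"
    and gauge_pos: "a < ereal u \<Longrightarrow> 0 < \<phi> u"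
    and deriv_pos: "a < ereal u \<Longrightarrow> 0 < g u"
    and gauge_vanishes: "((\<phi> \<circ> real_of_ereal) \<longlongrightarrow> 0) (at_right a)"
    and gauge_meas [measurable]: "\<phi> \<in> borel_measurable borel"
    and deriv_meas [measurable]: "g \<in> borel_measurable borel"
begin

lemma gauge_mono:
  assumes "a < ereal u" "u \<le> v"
  shows "\<phi> u \<le> \<phi> v"
proof (rule DERIV_nonneg_imp_nondecreasing[OF assms(2)])
  fix t assume "u \<le> t" "t \<le> v"
  with assms have "a < ereal t"
    by (meson ereal_less_eq(3) less_le_trans)
  then show "\<exists>y. DERIV \<phi> t :> y \<and> 0 \<le> y"
    using gauge_deriv deriv_pos less_imp_le by blast
qed

lemma gauge_small:
  assumes "a < ereal x" "0 < e"
  shows "\<exists>c. a < ereal c \<and> c < x \<and> \<phi> c < e"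
proof -
  have "\<forall>\<^sub>F y in at_right a. \<phi> (real_of_ereal y) < e"
    using order_tendstoD(2)[OF gauge_vanishes assms(2)] by simp
  then obtain b where b: "a < b" "\<And>y. a < y \<Longrightarrow> y < b \<Longrightarrow> \<phi> (real_of_ereal y) < e"
    using assms(1) by (auto simp: eventually_at_right)
  obtain c where "a < ereal c" "ereal c < min b (ereal x)"
    using ereal_dense2[of a "min b (ereal x)"] b(1) assms(1) by auto
  with b(2)[of "ereal c"] show ?thesis
    by auto
qed

text \<open>The convergent case: \<open>\<phi> ^ Suc n / Suc n\<close> is an antiderivative that
  vanishes at \<open>a\<close>. The nonnegative form of the fundamental theorem also yields
  integrability, which links its Lebesgue integral to the nonnegative one.\<close>

lemma nn_integral_gauge_power:
  assumes "a < ereal x"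
  shows "(\<integral>\<^sup>+ u \<in> {u. a < ereal u \<and> u < x}. ennreal (g u * \<phi> u ^ n) \<partial>lborel)
    = ennreal (\<phi> x ^ Suc n / real (Suc n))"
proof -
  let ?f = "\<lambda>u. g u * \<phi> u ^ n" and ?F = "\<lambda>u. \<phi> u ^ Suc n / real (Suc n)"
  have set_eq: "{u. a < ereal u \<and> u < x} = einterval a (ereal x)"
    by (auto simp: einterval_def)
  have F: "(?F has_real_derivative ?f u) (at u)" if "a < ereal u" for u
    using gauge_deriv[OF that]
    by (auto intro!: derivative_eq_intros simp: field_simps simp del: of_nat_Suc power_Suc)
  have f: "isCont ?f u" if "a < ereal u" for u
    by (intro continuous_mult continuous_power deriv_cont DERIV_isCont[OF gauge_deriv] that)
  have nonneg: "AE u in lborel. a < ereal u \<longrightarrow> ereal u < ereal x \<longrightarrow> 0 \<le> ?f u"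
    by (intro AE_I2) (auto simp: gauge_pos deriv_pos less_imp_le)
  have "((\<lambda>y. (\<phi> \<circ> real_of_ereal) y ^ Suc n / real (Suc n)) \<longlongrightarrow> 0 ^ Suc n / real (Suc n)) (at_right a)"
    by (intro tendsto_intros gauge_vanishes) auto
  then have A: "((?F \<circ> real_of_ereal) \<longlongrightarrow> 0) (at_right a)"
    by (simp add: o_def)
  have B: "((?F \<circ> real_of_ereal) \<longlongrightarrow> ?F x) (at_left (ereal x))"
    unfolding ereal_tendsto_simps
    using DERIV_isCont[OF F[OF assms]] by (simp add: isCont_def filterlim_at_split)
  note FTC = interval_integral_FTC_nonneg[OF assms F f nonneg A B]
  have "(\<integral>\<^sup>+ u. ennreal (indicator (einterval a (ereal x)) u *\<^sub>R ?f u) \<partial>lborel)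
      = ennreal (LINT u|lborel. indicator (einterval a (ereal x)) u *\<^sub>R ?f u)"
    using FTC(1) unfolding set_integrable_def
    by (intro nn_integral_eq_integral AE_I2)
       (auto simp: einterval_def indicator_def gauge_pos deriv_pos less_imp_le)
  also have "\<dots> = ennreal (?F x)"
    using FTC(2) assms
    by (simp add: interval_lebesgue_integral_def set_lebesgue_integral_def less_imp_le del: power_Suc of_nat_Suc)
  finally show ?thesis
    unfolding set_eq
    by (subst (asm) nn_integral_cong[where v = "\<lambda>u. ennreal (?f u) * indicator (einterval a (ereal x)) u"])
       (auto simp: indicator_def)
qed

text \<open>The divergent case, for all \<open>n\<close> at once: below \<open>x\<close> the
  integrand dominates the logarithmic derivative \<open>g / \<phi>\<close> divided by
  \<open>\<phi> x ^ n\<close>, and \<open>ln \<phi>\<close> is unbounded below near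
  \<open>a\<close>.\<close>

lemma nn_integral_gauge_inverse_power:
  assumes x: "a < ereal x"
  shows "(\<integral>\<^sup>+ u \<in> {u. a < ereal u \<and> u < x}. ennreal (g u / \<phi> u ^ Suc n) \<partial>lborel) = \<infinity>"
proof -
  let ?J = "\<integral>\<^sup>+ u \<in> {u. a < ereal u \<and> u < x}. ennreal (g u / \<phi> u ^ Suc n) \<partial>lborel"
  let ?K = "\<phi> x ^ n"
  have K: "0 < ?K"
    using gauge_pos[OF x] by simp
  have le: "ennreal r \<le> ?J" if r: "0 \<le> r" for r
  proof -
    \<comment> \<open>This bound on \<open>\<phi> c\<close> is what makes
      \<open>(ln (\<phi> x) - ln (\<phi> c)) / ?K\<close> at least \<open>r\<close>.\<close>
    obtain c where c: "a < ereal c" "c < x" "\<phi> c < \<phi> x * exp (- (?K * r))"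
      using gauge_small[OF x, of "\<phi> x * exp (- (?K * r))"] gauge_pos[OF x] by auto
    have above: "a < ereal u" if "c \<le> u" for u
      using c(1) that by (meson ereal_less_eq(3) less_le_trans)
    have "ln (\<phi> c) \<le> ln (\<phi> x * exp (- (?K * r)))"
      using c gauge_pos x by (intro ln_mono) auto
    also have "\<dots> = ln (\<phi> x) - ?K * r"
      using gauge_pos[OF x] by (simp add: ln_mult)
    finally have "r * ?K \<le> ln (\<phi> x) - ln (\<phi> c)"
      by (simp add: mult.commute)
    then have "r \<le> ln (\<phi> x) / ?K - ln (\<phi> c) / ?K"
      unfolding diff_divide_distrib[symmetric] pos_le_divide_eq[OF K] .
    then have "ennreal r \<le> ennreal (ln (\<phi> x) / ?K - ln (\<phi> c) / ?K)"
      by (rule ennreal_leI)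
    also have "\<dots> = (\<integral>\<^sup>+ u. ennreal (g u / (?K * \<phi> u)) * indicator {c..x} u \<partial>lborel)"
    proof (rule nn_integral_FTC_Icc[symmetric])
      fix u assume "u \<in> {c..x}"
      then have u: "a < ereal u"
        using above by simp
      show "((\<lambda>u. ln (\<phi> u) / ?K) has_real_derivative g u / (?K * \<phi> u)) (at u)"
        using gauge_pos[OF u] K
        by (auto intro!: derivative_eq_intros gauge_deriv[OF u] simp: field_simps)
      show "0 \<le> g u / (?K * \<phi> u)"
        using gauge_pos[OF u] deriv_pos[OF u] K by simp
    qed (use c in auto)
    also have "\<dots> \<le> ?J"
    proof (rule nn_integral_mono_AE)
      show "AE u in lborel. ennreal (g u / (?K * \<phi> u)) * indicator {c..x} u
          \<le> ennreal (g u / \<phi> u ^ Suc n) * indicator {u. a < ereal u \<and> u < x} u"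
        \<comment> \<open>The closed interval contains \<open>x\<close> but the domain of
          \<open>?J\<close> does not; the point is discarded as a null set.\<close>
        using AE_lborel_singleton[of x]
      proof eventually_elim
        case (elim u)
        show ?case
        proof (cases "c \<le> u \<and> u < x")
          case True
          then have u: "a < ereal u"
            using above by simp
          have "\<phi> u ^ n \<le> ?K"
            using True gauge_mono[OF u, of x] gauge_pos[OF u] by (intro power_mono) auto
          then have "g u / (?K * \<phi> u) \<le> g u / \<phi> u ^ Suc n"
            using gauge_pos[OF u] deriv_pos[OF u]
            by (intro divide_left_mono) (auto simp: mult_right_mono mult.commute K)
          then show ?thesis
            using u True by (auto intro: ennreal_leI)
        next
          case False
          with elim show ?thesis
            by (auto simp: indicator_def)
        qed
      qed
    qed
    finally show ?thesis .
  qed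
  show ?thesis
  proof (cases ?J)
    case (real r)
    with le[of "r + 1"] show ?thesis
      by simp
  qed simp
qed

text \<open>Lets divergence pass through further integrations. Comparison with a divergent integral
  replaces a computation of the measure of the domain.\<close>

lemma nn_integral_infinity_left:
  assumes "a < ereal x"
  shows "(\<integral>\<^sup>+ u \<in> {u. a < ereal u \<and> u < x}. \<infinity> \<partial>lborel) = \<infinity>"
proof -
  have "(\<integral>\<^sup>+ u \<in> {u. a < ereal u \<and> u < x}. ennreal (g u / \<phi> u ^ Suc 0) \<partial>lborel)
      \<le> (\<integral>\<^sup>+ u \<in> {u. a < ereal u \<and> u < x}. \<infinity> \<partial>lborel)"
    by (intro nn_integral_mono mult_right_mono) auto
  then show ?thesis
    unfolding nn_integral_gauge_inverse_power[OF assms] by (simp add: top_unique)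
qed

section \<open>The weights and their iterated integrals\<close>

text \<open>The two conditionals are \<open>S k\<close> and \<open>S (k - 1)\<close>. At
  \<open>k = 0\<close> truncated subtraction gives \<open>k - 1 = 0\<close>, so the denominator is
  \<open>\<phi> u\<close> whether or not \<open>0\<close> lies in \<open>M\<close>.\<close>

definition weight :: "nat set \<Rightarrow> nat \<Rightarrow> real \<Rightarrow> real" where
  "weight M k u = g u * \<phi> u ^ (if k \<in> M then k else 0)
     / \<phi> u ^ Suc (if k - 1 \<in> M then k - 1 else 0)"

lemma weight_pos: "a < ereal u \<Longrightarrow> 0 < weight M k u"
  by (simp add: weight_def gauge_pos deriv_pos)

lemma weight_meas: "weight M k \<in> borel_measurable borel"
  unfolding weight_def by measurable

lemma weight_cont:
  assumes "a < ereal u"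
  shows "isCont (weight M k) u"
  unfolding weight_def
  using gauge_pos[OF assms] deriv_cont[OF assms] DERIV_isCont[OF gauge_deriv[OF assms]]
  by (intro continuous_intros) auto

text \<open>Downward induction from \<open>C = 1\<close> at \<open>k = m\<close>. Integrating level
  \<open>k + 1\<close> leaves a multiple of \<open>\<phi> ^ (m - S k)\<close>, and the factor
  \<open>\<phi> ^ S k\<close> of the next weight restores the power \<open>m\<close>.\<close>

lemma p_iter_weight_finite:
  assumes "k \<le> m" "m \<in> M"
  shows "\<exists>C\<ge>0. \<forall>x. a < ereal x \<longrightarrow> p_iter a (weight M) k m x
    = ennreal (C * (g x * \<phi> x ^ m / \<phi> x ^ Suc (if k - 1 \<in> M then k - 1 else 0)))"
  using assms(1)
proof (induction k rule: inc_induct)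
  case base
  show ?case
    using assms(2) by (intro exI[of _ 1]) (simp add: p_iter.simps[of _ _ m] weight_def)
next
  case (step k)
  let ?s = "if k \<in> M then k else 0"
  let ?t = "if k - 1 \<in> M then k - 1 else 0"
  \<comment> \<open>The net exponent of the integrand. Since \<open>S k \<le> k < m\<close>, the
    subtraction is not truncated.\<close>
  define n where "n = m - Suc ?s"
  have n: "m = Suc n + ?s"
    using step.hyps unfolding n_def by auto
  obtain C where C: "0 \<le> C" "\<And>x. a < ereal x \<Longrightarrow>
      p_iter a (weight M) (Suc k) m x = ennreal (C * (g x * \<phi> x ^ m / \<phi> x ^ Suc ?s))"
    using step.IH by (metis diff_Suc_1)
  show ?case
  proof (intro exI[of _ "C / real (Suc n)"] conjI allI impI)
    show "0 \<le> C / real (Suc n)"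
      using C(1) by simp
    fix x assume x: "a < ereal x"
    have "(\<integral>\<^sup>+ u \<in> {u. a < ereal u \<and> u < x}. p_iter a (weight M) (Suc k) m u \<partial>lborel)
        = (\<integral>\<^sup>+ u. ennreal C * (ennreal (g u * \<phi> u ^ n) * indicator {u. a < ereal u \<and> u < x} u) \<partial>lborel)"
    proof (rule nn_integral_cong)
      fix u
      have "C * (g u * \<phi> u ^ m / \<phi> u ^ Suc ?s) = C * (g u * \<phi> u ^ n)" if "a < ereal u"
        using gauge_pos[OF that] by (subst n) (simp add: power_add)
      then show "p_iter a (weight M) (Suc k) m u * indicator {u. a < ereal u \<and> u < x} u
          = ennreal C * (ennreal (g u * \<phi> u ^ n) * indicator {u. a < ereal u \<and> u < x} u)"
        using C by (simp add: indicator_def ennreal_mult')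
    qed
    also have "\<dots> = ennreal C * ennreal (\<phi> x ^ Suc n / real (Suc n))"
      unfolding nn_integral_gauge_power[OF x, symmetric] by (rule nn_integral_cmult) measurable
    finally have "p_iter a (weight M) k m x
        = ennreal (weight M k x) * (ennreal C * ennreal (\<phi> x ^ Suc n / real (Suc n)))"
      using step.hyps by (simp add: p_iter.simps[of _ _ k])
    also have "\<dots> = ennreal (weight M k x * (C * (\<phi> x ^ Suc n / real (Suc n))))"
      using C(1) weight_pos[OF x, of M k] gauge_pos[OF x]
      by (simp only: ennreal_mult[symmetric] mult_nonneg_nonneg divide_nonneg_nonneg
          zero_le_power of_nat_0_le_iff less_imp_le)
    also have "weight M k x * (C * (\<phi> x ^ Suc n / real (Suc n)))
        = C / real (Suc n) * (g x * \<phi> x ^ m / \<phi> x ^ Suc ?t)"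
      by (subst n) (simp only: weight_def power_add times_divide_eq_left times_divide_eq_right ac_simps)
    finally show "p_iter a (weight M) k m x = ennreal (C / real (Suc n) * (g x * \<phi> x ^ m / \<phi> x ^ Suc ?t))" .
  qed
qed

text \<open>As \<open>S m = 0\<close>, the innermost integrand is \<open>g\<close> over a positive
  power of \<open>\<phi>\<close>; the resulting infinity persists at all outer levels.\<close>

lemma p_iter_weight_infinite:
  assumes "k < m" "m \<notin> M" "a < ereal x"
  shows "p_iter a (weight M) k m x = \<infinity>"
  using assms(1,3)
proof (induction k arbitrary: x rule: strict_inc_induct)
  case (base k)
  have inner: "p_iter a (weight M) (Suc k) m u
      = ennreal (g u / \<phi> u ^ Suc (if m - 1 \<in> M then m - 1 else 0))" for u
    unfolding base(1)[symmetric] using assms(2) by (simp add: p_iter.simps[of _ _ m] weight_def)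
  have "(\<integral>\<^sup>+ u \<in> {u. a < ereal u \<and> u < x}. p_iter a (weight M) (Suc k) m u \<partial>lborel) = \<infinity>"
    unfolding inner by (rule nn_integral_gauge_inverse_power[OF base(2)])
  then show ?case
    \<comment> \<open>Strict positivity matters, because zero times infinity is zero in
      \<open>ennreal\<close>.\<close>
    using base weight_pos[OF base(2), of M k]
    by (simp add: p_iter.simps[of _ _ k] ennreal_mult_eq_top_iff)
next
  case (step k)
  have "(\<integral>\<^sup>+ u \<in> {u. a < ereal u \<and> u < x}. p_iter a (weight M) (Suc k) m u \<partial>lborel)
      = (\<integral>\<^sup>+ u \<in> {u. a < ereal u \<and> u < x}. \<infinity> \<partial>lborel)"
    using step.IH by (intro nn_integral_cong) (simp add: indicator_def)
  then show ?case
    using step.hyps weight_pos[OF step.prems, of M k] nn_integral_infinity_left[OF step.prems]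
    by (simp add: p_iter.simps[of _ _ k] ennreal_mult_eq_top_iff)
qed

lemma F_set_weight:
  assumes "I \<noteq> {}" "\<And>x. x \<in> I \<Longrightarrow> a < ereal x" "M \<subseteq> {j + 1..}"
  shows "F_set a I (weight M) j - {j} = M"
proof (intro set_eqI iffI)
  fix m assume m: "m \<in> F_set a I (weight M) j - {j}"
  \<comment> \<open>A single point of \<open>I\<close> suffices to refute finiteness when
    \<open>m\<close> is outside \<open>M\<close>.\<close>
  obtain x where x: "x \<in> I"
    using assms(1) by blast
  have "j < m" "p_iter a (weight M) j m x \<noteq> \<infinity>"
    using m x by (auto simp: F_set_def)
  then show "m \<in> M"
    using p_iter_weight_infinite assms(2)[OF x] by blast
next
  fix m assume m: "m \<in> M"
  then have j: "j < m"
    using assms(3) by auto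
  have "p_iter a (weight M) j m x < \<infinity>" if "x \<in> I" for x
    using p_iter_weight_finite[of j m M] m j assms(2)[OF that] by fastforce
  then show "m \<in> F_set a I (weight M) j - {j}"
    using j by (auto simp: F_set_def)
qed

end

section \<open>Choice of the gauge and conclusion\<close>

lemma vanishing_gauge_exists:
  assumes "a < \<infinity>"
  shows "\<exists>\<phi> g. vanishing_gauge a \<phi> g"
proof (cases a)
  case (real r)
  have "((\<lambda>u. u - r) \<longlongrightarrow> r - r) (at_right r)"
    by (intro tendsto_intros)
  then have "vanishing_gauge a (\<lambda>u. u - r) (\<lambda>_. 1)"
    unfolding real
    by unfold_locales (auto intro!: derivative_eq_intros simp: ereal_tendsto_simps)
  then show ?thesis
    by blast
next
  case MInf
  have "vanishing_gauge a exp exp"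
    unfolding MInf
    by unfold_locales (auto intro!: derivative_eq_intros exp_at_bot simp: ereal_tendsto_simps)
  then show ?thesis
    by blast
qed (use assms in simp)

theorem proposition3p3:
  fixes I :: "real set" and a :: ereal and j :: nat and M :: "nat set"
  assumes "is_interval I"
    and "\<exists>x\<in>I. \<exists>y\<in>I. x < y"
    and "a = Inf (ereal ` I)"
    and "a \<notin> ereal ` I"
    and "M \<subseteq> {j + 1..}"
  shows "\<exists>w :: nat \<Rightarrow> real \<Rightarrow> real.
    (\<forall>k. w k \<in> borel_measurable (restrict_space borel I)
       \<and> (\<forall>x\<in>I. 0 < w k x)
       \<and> (\<forall>K. compact K \<and> K \<subseteq> I \<longrightarrow> bounded (w k ` K)))
    \<and> F_set a I w j - {j} = M"
proof -
  \<comment> \<open>The infimum is a lower bound, and it is strict because \<open>a\<close> is not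
    attained in \<open>I\<close>.\<close>
  have a_less: "a < ereal x" if "x \<in> I" for x
    using that assms(3,4) by (metis INF_lower image_eqI order_le_less)
  obtain x where "x \<in> I"
    using assms(2) by blast
  then have "I \<noteq> {}" "a < \<infinity>"
    using a_less less_trans[of a "ereal x" \<infinity>] by auto
  then obtain \<phi> g where "vanishing_gauge a \<phi> g"
    using vanishing_gauge_exists by blast
  then interpret vanishing_gauge a \<phi> g .
  show ?thesis
  proof (intro exI[of _ "weight M"] conjI allI ballI impI)
    fix k
    show "weight M k \<in> borel_measurable (restrict_space borel I)"
      by (rule measurable_restrict_space1[OF weight_meas])
    show "0 < weight M k x" if "x \<in> I" for x
      using a_less[OF that] by (rule weight_pos)
    \<comment> \<open>The weights are continuous to the right of \<open>a\<close>, so the image of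
      \<open>K\<close> is compact.\<close>
    show "bounded (weight M k ` K)" if "compact K \<and> K \<subseteq> I" for K
      using that a_less weight_cont
      by (intro compact_imp_bounded compact_continuous_image continuous_at_imp_continuous_on) auto
    show "F_set a I (weight M) j - {j} = M"
      using \<open>I \<noteq> {}\<close> a_less assms(5) by (rule F_set_weight)
  qed
qed

end
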